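(* Let $M\ge 2$, let $\bm X\in\mathbb R^{n\times p}$ and $\bm y\in\mathbb R^n$ be split into $M$ row blocks $\bm X=(\bm X_1^\top,\dots,\bm X_M^\top)^\top$, $\bm y=(\bm y_1^\top,\dots,\bm y_M^\top)^\top$ with $\bm X_m\in\mathbb R^{n_m\times p}$, $\bm y_m\in\mathbb R^{n_m}$, $\sum_{m=1}^M n_m=n$. Let $\{\hat{\bm\beta}^k,\hat{\bm r}^k,\hat{\bm d}^k\}$ be the $k$-th iterate of the LADMM algorithm (Algorithm 1 in the context) and $\{\tilde{\bm\beta}^k,\tilde{\bm r}^k,\tilde{\bm d}^k\}$ the $k$-th iterate of the parallel LADMM algorithm with these $M$ blocks (Algorithm 2 in the context), where $\tilde{\bm r}^k=(\tilde{\bm r}_1^{k\top},\dots,\tilde{\bm r}_M^{k\top})^\top$ and $\tilde{\bm d}^k=(\tilde{\bm d}_1^{k\top},\dots,\tilde{\bm d}_M^{k\top})^\top$, both algorithms being applied to the same problem with the same parameter $\mu$. If the two algorithms use the same initial iteration variables, $\{\hat{\bm\beta}^0,\hat{\bm r}^0,\hat{\bm d}^0\}=\{\tilde{\bm\beta}^0,\tilde{\bm r}^0,\tilde{\bm d}^0\}$, and the same $\eta$, then $$\{\hat{\bm\beta}^k,\hat{\bm r}^k,\hat{\bm d}^k\}=\{\tilde{\bm\beta}^k,\tilde{\bm r}^k,\tilde{\bm d}^k\}\quad\text{for all }k .$$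
   Context: Fix $\tau\in(0,1)$, $c>0$, $\kappa>0$, $\mu>0$, $\eta>0$. $\mathcal L_{\tau,*}:\mathbb R\to\mathbb R$ denotes either of the two smooth quantile losses: $\mathcal L_{\tau,c}(u)=\tau(u-0.5c)$ if $u\ge c$; $\frac{\tau u^2}{2c}$ if $0\le u<c$; $\frac{(1-\tau)u^2}{2c}$ if $-c\le u<0$; $(\tau-1)(u+0.5c)$ if $u<-c$; $\mathcal L_{\tau,\kappa}(u)=\tau(u-\frac{\tau\kappa}{2})$ if $u>\tau\kappa$; $\frac{u^2}{2\kappa}$ if $(\tau-1)\kappa\le u\le\tau\kappa$; $(\tau-1)[u-\frac{(\tau-1)\kappa}{2}]$ if $u<(\tau-1)\kappa$. For a vector, $\mathcal L_{\tau,*}(\bm r)=\sum_i\mathcal L_{\tau,*}(r_i)$. Penalty: $P_\lambda(|\bm\beta|)=\sum_{j=1}^p P_\lambda(|\beta_j|)$ with, for $u\ge 0$, $P_\lambda(u)=q(u)+\frac{\lambda_2}{2}u^2$, $\lambda_1>0$, $\lambda_2\ge0$, where $q$ is one of: SCAD ($a>2$): $q(0)=0$, $q'(u)=\lambda_1$ for $u\le\lambda_1$, $q'(u)=\frac{a\lambda_1-u}{a-1}$ for $\lambda_1<u<a\lambda_1$, $q'(u)=0$ for $u\ge a\lambda_1$; MCP ($a>1$): $q(u)=\lambda_1u-\frac{u^2}{2a}$ for $u\le a\lambda_1$, $q(u)=\frac{a\lambda_1^2}{2}$ for $u>a\lambda_1$; Capped-$\ell_1$ ($a>0$): $q(u)=\lambda_1\min\{u,a\}$.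 (With the $\lambda_2$ term these are called Snet, Mnet, Cnet respectively.) Proximal operator: $\operatorname{prox}_{\nu,g}(\bm v)=\arg\min_{\bm u}\{g(\bm u)+\frac{\nu}{2}\|\bm u-\bm v\|_2^2\}$; it is treated as a single-valued map (when the minimizer is not unique, a fixed selection of a minimizer, the same one in both algorithms). Both algorithms address $\min_{\bm\beta,\bm r}\mathcal L_{\tau,*}(\bm r)+P_\lambda(|\bm\beta|)$ subject to $\bm X\bm\beta+\bm r=\bm y$. Algorithm 1 (LADMM): given $\bm\beta^0,\bm r^0,\bm d^0$, for $k=0,1,2,\dots$: $\bm\beta^{k+1}=\operatorname{prox}_{\eta,P_\lambda}\big(\bm\beta^k-\frac{\mu\bm X^\top(\bm X\bm\beta^k+\bm r^k-\bm y-\bm d^k/\mu)}{\eta}\big)$; $\bm r^{k+1}=\operatorname{prox}_{\mu,\mathcal L_{\tau,*}}(\bm y+\bm d^k/\mu-\bm X\bm\beta^{k+1})$; $\bm d^{k+1}=\bm d^k-\mu(\bm X\bm\beta^{k+1}+\bm r^{k+1}-\bm y)$. Algorithm 2 (parallel LADMM): given $\bm\beta^0$ and $\bm r_m^0,\bm d_m^0\in\mathbb R^{n_m}$ ($m=1,\dots,M$), for $k=0,1,2,\dots$, with $\bm\xi_m^k=\bm X_m^\top(\bm X_m\bm\beta^k+\bm r_m^k-\bm y_m-\bm d_m^k/\mu)$: $\bm\beta^{k+1}=\operatorname{prox}_{\eta,P_\lambda}\big(\bm\beta^k-\frac{\mu}{\eta}\sum_{m=1}^M\bm\xi_m^k\big)$;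 $\bm r_m^{k+1}=\operatorname{prox}_{\mu,\mathcal L_{\tau,*}}(\bm y_m+\bm d_m^k/\mu-\bm X_m\bm\beta^{k+1})$ for $m=1,\dots,M$; $\bm d_m^{k+1}=\bm d_m^k-\mu(\bm X_m\bm\beta^{k+1}+\bm r_m^{k+1}-\bm y_m)$ for $m=1,\dots,M$. *)

theory Defs
  imports Complex_Main "Jordan_Normal_Form.Matrix"
begin

definition quantile_loss_c :: "real \<Rightarrow> real \<Rightarrow> real \<Rightarrow> real" where
  "quantile_loss_c \<tau> c u =
     (if u \<ge> c then \<tau> * (u - 0.5 * c)
      else if 0 \<le> u then \<tau> * u\<^sup>2 / (2 * c)
      else if -c \<le> u then (1 - \<tau>) * u\<^sup>2 / (2 * c)
      else (\<tau> - 1) * (u + 0.5 * c))"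

definition quantile_loss_kappa :: "real \<Rightarrow> real \<Rightarrow> real \<Rightarrow> real" where
  "quantile_loss_kappa \<tau> \<kappa> u =
     (if u > \<tau> * \<kappa> then \<tau> * (u - \<tau> * \<kappa> / 2)
      else if (\<tau> - 1) * \<kappa> \<le> u then u\<^sup>2 / (2 * \<kappa>)
      else (\<tau> - 1) * (u - (\<tau> - 1) * \<kappa> / 2))"

definition vec_loss :: "(real \<Rightarrow> real) \<Rightarrow> real vec \<Rightarrow> real" where
  "vec_loss L r = (\<Sum>i<dim_vec r. L (r $ i))"

definition scad_deriv :: "real \<Rightarrow> real \<Rightarrow> real \<Rightarrow> real" where
  "scad_deriv lam1 a u =
     (if u \<le> lam1 then lam1
      else if u < a * lam1 then (a * lam1 - u) / (a - 1)
      else 0)"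

text \<open>SCAD is given by its value at 0 and its derivative on the half-line (one-sided at 0), which
  determine it there; its values at negative arguments are irrelevant.\<close>

definition is_scad :: "real \<Rightarrow> real \<Rightarrow> (real \<Rightarrow> real) \<Rightarrow> bool" where
  "is_scad lam1 a q \<longleftrightarrow>
     q 0 = 0 \<and> (\<forall>u\<ge>0. (q has_real_derivative scad_deriv lam1 a u) (at u within {0..}))"

definition mcp :: "real \<Rightarrow> real \<Rightarrow> real \<Rightarrow> real" where
  "mcp lam1 a u = (if u \<le> a * lam1 then lam1 * u - u\<^sup>2 / (2 * a) else a * lam1\<^sup>2 / 2)"

definition capped_l1 :: "real \<Rightarrow> real \<Rightarrow> real \<Rightarrow> real" where
  "capped_l1 lam1 a u = lam1 * min u a"

definition penalty :: "(real \<Rightarrow> real) \<Rightarrow> real \<Rightarrow> real \<Rightarrow> real" where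
  "penalty q lam2 u = q u + lam2 / 2 * u\<^sup>2"

definition vec_penalty :: "(real \<Rightarrow> real) \<Rightarrow> real \<Rightarrow> real vec \<Rightarrow> real" where
  "vec_penalty q lam2 \<beta> = (\<Sum>j<dim_vec \<beta>. penalty q lam2 \<bar>\<beta> $ j\<bar>)"

definition is_prox :: "real \<Rightarrow> (real vec \<Rightarrow> real) \<Rightarrow> real vec \<Rightarrow> real vec \<Rightarrow> bool" where
  "is_prox \<nu> g v =
     is_arg_min (\<lambda>u. g u + \<nu> / 2 * ((u - v) \<bullet> (u - v))) (\<lambda>u. u \<in> carrier_vec (dim_vec v))"

text \<open>A single-valued proximal operator: an arbitrary selection of a minimizer, depending on nothing
  but the parameter, the function and the point. It never changes the dimension; nothing else is
  required of it at points where there is no minimizer.\<close>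

definition prox_selection :: "(real \<Rightarrow> (real vec \<Rightarrow> real) \<Rightarrow> real vec \<Rightarrow> real vec) \<Rightarrow> bool" where
  "prox_selection prox \<longleftrightarrow>
     (\<forall>\<nu> g v. prox \<nu> g v \<in> carrier_vec (dim_vec v) \<and>
        ((\<exists>u. is_prox \<nu> g v u) \<longrightarrow> is_prox \<nu> g v (prox \<nu> g v)))"

lemma ex_prox_selection: "\<exists>prox. prox_selection prox"
proof -
  have "\<exists>w. w \<in> carrier_vec (dim_vec v) \<and> ((\<exists>u. is_prox \<nu> g v u) \<longrightarrow> is_prox \<nu> g v w)" for \<nu> g v
  proof (cases "\<exists>u. is_prox \<nu> g v u")
    case True
    then obtain u where u: "is_prox \<nu> g v u" by blast
    then have "u \<in> carrier_vec (dim_vec v)" unfolding is_prox_def is_arg_min_def by (rule conjunct1)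
    with u show ?thesis by blast
  next
    case False
    then show ?thesis using carrier_vec_dim_vec[of v] by blast
  qed
  then have "\<forall>\<nu> g v. \<exists>w. w \<in> carrier_vec (dim_vec v) \<and> ((\<exists>u. is_prox \<nu> g v u) \<longrightarrow> is_prox \<nu> g v w)"
    by (intro allI)
  then show ?thesis unfolding prox_selection_def choice_iff .
qed

text \<open>Blocks are indexed by \<open>1,\<dots>,M\<close> and stacked from top to bottom in this order.\<close>

primrec stack_rows :: "nat \<Rightarrow> nat \<Rightarrow> (nat \<Rightarrow> real mat) \<Rightarrow> real mat" where
  "stack_rows p 0 A = 0\<^sub>m 0 p"
| "stack_rows p (Suc m) A = stack_rows p m A @\<^sub>r A (Suc m)"

primrec stack_vec :: "nat \<Rightarrow> (nat \<Rightarrow> real vec) \<Rightarrow> real vec" where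
  "stack_vec 0 v = 0\<^sub>v 0"
| "stack_vec (Suc m) v = stack_vec m v @\<^sub>v v (Suc m)"

definition is_ladmm ::
  "(real \<Rightarrow> (real vec \<Rightarrow> real) \<Rightarrow> real vec \<Rightarrow> real vec) \<Rightarrow> (real vec \<Rightarrow> real) \<Rightarrow> (real vec \<Rightarrow> real)
    \<Rightarrow> real \<Rightarrow> real \<Rightarrow> real mat \<Rightarrow> real vec
    \<Rightarrow> (nat \<Rightarrow> real vec) \<Rightarrow> (nat \<Rightarrow> real vec) \<Rightarrow> (nat \<Rightarrow> real vec) \<Rightarrow> bool" where
  "is_ladmm prox L P \<mu> \<eta> X y \<beta> r d \<longleftrightarrow>
     (\<forall>k.
        \<beta> (Suc k) = prox \<eta> P
          (\<beta> k - (\<mu> / \<eta>) \<cdot>\<^sub>v (X\<^sup>T *\<^sub>v (X *\<^sub>v \<beta> k + r k - y - (1 / \<mu>) \<cdot>\<^sub>v d k))) \<and>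
        r (Suc k) = prox \<mu> L (y + (1 / \<mu>) \<cdot>\<^sub>v d k - X *\<^sub>v \<beta> (Suc k)) \<and>
        d (Suc k) = d k - \<mu> \<cdot>\<^sub>v (X *\<^sub>v \<beta> (Suc k) + r (Suc k) - y))"

text \<open>In the parallel algorithm \<open>r k m\<close> and \<open>d k m\<close> are the parts of the \<open>k\<close>-th iterate that
  belong to block \<open>m\<close>; \<open>p\<close> is the dimension of \<open>\<beta> k\<close>.\<close>

definition is_parallel_ladmm ::
  "(real \<Rightarrow> (real vec \<Rightarrow> real) \<Rightarrow> real vec \<Rightarrow> real vec) \<Rightarrow> (real vec \<Rightarrow> real) \<Rightarrow> (real vec \<Rightarrow> real)
    \<Rightarrow> real \<Rightarrow> real \<Rightarrow> nat \<Rightarrow> nat \<Rightarrow> (nat \<Rightarrow> real mat) \<Rightarrow> (nat \<Rightarrow> real vec)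
    \<Rightarrow> (nat \<Rightarrow> real vec) \<Rightarrow> (nat \<Rightarrow> nat \<Rightarrow> real vec) \<Rightarrow> (nat \<Rightarrow> nat \<Rightarrow> real vec) \<Rightarrow> bool" where
  "is_parallel_ladmm prox L P \<mu> \<eta> p M X y \<beta> r d \<longleftrightarrow>
     (\<forall>k.
        (let \<xi> = (\<lambda>m. (X m)\<^sup>T *\<^sub>v (X m *\<^sub>v \<beta> k + r k m - y m - (1 / \<mu>) \<cdot>\<^sub>v d k m))
         in \<beta> (Suc k) = prox \<eta> P (\<beta> k - (\<mu> / \<eta>) \<cdot>\<^sub>v finsum_vec TYPE(real) p \<xi> {1..M})) \<and>
        (\<forall>m\<in>{1..M}.
           r (Suc k) m = prox \<mu> L (y m + (1 / \<mu>) \<cdot>\<^sub>v d k m - X m *\<^sub>v \<beta> (Suc k)) \<and>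
           d (Suc k) m = d k m - \<mu> \<cdot>\<^sub>v (X m *\<^sub>v \<beta> (Suc k) + r (Suc k) m - y m)))"

end

theory Submission
  imports Defs
begin

text \<open>Both smooth quantile losses are nonnegative combinations of a one-sided Huber function of \<open>u\<close> and
  of \<open>- u\<close>, hence convex with a continuous bounded derivative. So each scalar proximal problem
  has exactly one minimizer, and the vector problem separates: the proximal map of the loss acts
  coordinatewise, whatever the selection, and therefore commutes with stacking blocks. The penalty
  needs no such analysis: the two algorithms apply its proximal map to the same point, because
  \<open>X\<^sup>T v = (\<Sum>m. X\<^sub>m\<^sup>T v\<^sub>m)\<close>.\<close>

section \<open>Scalar proximal problems\<close>

text \<open>The strict inequality builds uniqueness in: only a unique minimizer pins down the value
  of an arbitrary selection.\<close>

definition strict_prox :: "(real \<Rightarrow> real) \<Rightarrow> real \<Rightarrow> real \<Rightarrow> real \<Rightarrow> bool" where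
  "strict_prox L \<nu> v s \<longleftrightarrow> (\<forall>u. u \<noteq> s \<longrightarrow> L s + \<nu> / 2 * (s - v)\<^sup>2 < L u + \<nu> / 2 * (u - v)\<^sup>2)"

text \<open>The quadratic term exceeds its tangent at \<open>s\<close> by
  \<open>\<nu> / 2 * (u - s)\<^sup>2\<close>, and stationarity makes the slope of that tangent
  cancel \<open>g\<close>.\<close>

lemma strict_prox_if_subgradient:
  assumes "0 < \<nu>"
    and subgrad: "\<And>u. L s + g * (u - s) \<le> L u"
    and stationary: "g + \<nu> * (s - v) = 0"
  shows "strict_prox L \<nu> v s"
  unfolding strict_prox_def
proof (intro allI impI)
  fix u assume "u \<noteq> s"
  have "\<nu> / 2 * (u - v)\<^sup>2 - \<nu> / 2 * (s - v)\<^sup>2 = \<nu> * (s - v) * (u - s) + \<nu> / 2 * (u - s)\<^sup>2"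
    by (simp add: power2_eq_square field_simps)
  moreover have "\<nu> * (s - v) * (u - s) = - (g * (u - s))"
    using stationary by (simp add: eq_neg_iff_add_eq_0 flip: distrib_right)
  moreover have "0 < \<nu> / 2 * (u - s)\<^sup>2"
    using \<open>u \<noteq> s\<close> \<open>0 < \<nu>\<close> by simp
  ultimately show "L s + \<nu> / 2 * (s - v)\<^sup>2 < L u + \<nu> / 2 * (u - v)\<^sup>2"
    using subgrad[of u] by linarith
qed

text \<open>A stationary point comes from the intermediate value theorem, applied to the slope of
  the proximal objective.\<close>

lemma strict_prox_exists:
  assumes "0 < \<nu>"
    and cont: "continuous_on UNIV g"
    and bound: "\<And>u. \<bar>g u\<bar> \<le> B"
    and subgrad: "\<And>s u. L s + g s * (u - s) \<le> L u"
  shows "\<exists>s. strict_prox L \<nu> v s"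
proof -
  let ?F = "\<lambda>s. g s + \<nu> * (s - v)"
  have "0 \<le> B" using bound[of 0] by linarith
  \<comment> \<open>At distance \<open>B / \<nu>\<close> from \<open>v\<close> the quadratic term
    has slope of size \<open>B\<close>, which dominates \<open>g\<close> and fixes the sign.\<close>
  have "?F (v - B / \<nu>) \<le> 0"
    using bound[of "v - B / \<nu>"] \<open>0 < \<nu>\<close> by (simp add: abs_le_iff)
  moreover have "0 \<le> ?F (v + B / \<nu>)"
    using bound[of "v + B / \<nu>"] \<open>0 < \<nu>\<close> by (simp add: abs_le_iff)
  moreover have "v - B / \<nu> \<le> v + B / \<nu>"
    using divide_nonneg_pos[OF \<open>0 \<le> B\<close> \<open>0 < \<nu>\<close>] by linarith
  moreover have "continuous_on {v - B / \<nu>..v + B / \<nu>} ?F"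
    by (intro continuous_intros continuous_on_subset[OF cont]) simp
  ultimately obtain s where "?F s = 0"
    using IVT'[of ?F "v - B / \<nu>" 0 "v + B / \<nu>"] by blast
  then show ?thesis
    using strict_prox_if_subgradient[of \<nu> L s "g s" v] \<open>0 < \<nu>\<close> subgrad by blast
qed

section \<open>One-sided Huber functions and their subgradients\<close>

definition pos_huber :: "real \<Rightarrow> real \<Rightarrow> real" where
  "pos_huber A u = (if A \<le> u then u - A / 2 else if 0 \<le> u then u\<^sup>2 / (2 * A) else 0)"

text \<open>For \<open>A\<close> positive, \<open>pos_huber A\<close> is the Moreau envelope of the
  positive part. Writing its derivative as a clipped ratio makes continuity and the bounds
  immediate.\<close>

definition pos_huber_deriv :: "real \<Rightarrow> real \<Rightarrow> real" where
  "pos_huber_deriv A u = max 0 (min 1 (u / A))"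

lemma pos_huber_deriv_bounds: "0 \<le> pos_huber_deriv A u" "pos_huber_deriv A u \<le> 1"
  unfolding pos_huber_deriv_def by auto

text \<open>Fenchel duality: \<open>A t\<^sup>2 / 2\<close> on \<open>[0, 1]\<close> is the convex conjugate.\<close>

lemma pos_huber_ge:
  assumes "0 < A" "0 \<le> t" "t \<le> 1"
  shows "t * u - A * t\<^sup>2 / 2 \<le> pos_huber A u"
proof -
  consider "A \<le> u" | "0 \<le> u" "u < A" | "u < 0" by linarith
  then show ?thesis
  proof cases
    case 1
    have "u - A / 2 - (t * u - A * t\<^sup>2 / 2) = (1 - t) * (u - A) + A / 2 * (1 - t)\<^sup>2"
      by (simp add: power2_eq_square field_simps)
    moreover have "0 \<le> (1 - t) * (u - A) + A / 2 * (1 - t)\<^sup>2"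
      using assms 1 by simp
    ultimately show ?thesis using 1 by (simp add: pos_huber_def)
  next
    case 2
    have "u\<^sup>2 / (2 * A) - (t * u - A * t\<^sup>2 / 2) = (u - A * t)\<^sup>2 / (2 * A)"
      using assms by (simp add: power2_eq_square field_simps)
    moreover have "0 \<le> (u - A * t)\<^sup>2 / (2 * A)"
      using assms by simp
    moreover have "pos_huber A u = u\<^sup>2 / (2 * A)"
      using 2 by (simp add: pos_huber_def)
    ultimately show ?thesis by linarith
  next
    case 3
    then have "t * u \<le> 0" using assms by (simp add: mult_nonneg_nonpos)
    moreover have "0 \<le> A * t\<^sup>2 / 2" using assms by simp
    moreover have "pos_huber A u = 0" using 3 assms by (simp add: pos_huber_def)
    ultimately show ?thesis by linarith
  qed
qed

text \<open>The equality case of Fenchel-Young: the derivative is the slope \<open>t\<close> at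
  which the lower bound of \<open>pos_huber_ge\<close> is attained.\<close>

lemma pos_huber_eq:
  assumes "0 < A"
  shows "pos_huber A u = pos_huber_deriv A u * u - A * (pos_huber_deriv A u)\<^sup>2 / 2"
proof -
  consider "A \<le> u" | "0 \<le> u" "u < A" | "u < 0" by linarith
  then show ?thesis
  proof cases
    case 1
    then have "pos_huber_deriv A u = 1" using assms by (simp add: pos_huber_deriv_def)
    then show ?thesis using 1 by (simp add: pos_huber_def)
  next
    case 2
    then have "pos_huber_deriv A u = u / A" using assms by (simp add: pos_huber_deriv_def)
    moreover have "pos_huber A u = u\<^sup>2 / (2 * A)"
      using 2 by (simp add: pos_huber_def)
    ultimately show ?thesis
      using assms by (simp only:) (simp add: power2_eq_square field_simps)
  next
    case 3
    then have "pos_huber_deriv A u = 0"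
      using assms divide_neg_pos[of u A] by (simp add: pos_huber_deriv_def)
    then show ?thesis using 3 assms by (simp add: pos_huber_def)
  qed
qed

text \<open>With \<open>t\<close> fixed as the derivative at \<open>s\<close>, the Fenchel bound is
  affine in \<open>u\<close> and touches the graph at \<open>s\<close>; the conjugate terms
  cancel.\<close>

lemma pos_huber_subgradient:
  assumes "0 < A"
  shows "pos_huber A s + pos_huber_deriv A s * (u - s) \<le> pos_huber A u"
  using pos_huber_ge[OF assms pos_huber_deriv_bounds, of A s u] pos_huber_eq[OF assms, of s]
  by (simp add: right_diff_distrib)

lemma strict_prox_huber_exists:
  assumes "0 < \<nu>" "0 \<le> \<tau>" "\<tau> \<le> 1" "0 < A" "0 < B"
  shows "\<exists>s. strict_prox (\<lambda>u. \<tau> * pos_huber A u + (1 - \<tau>) * pos_huber B (- u)) \<nu> v s"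
proof (rule strict_prox_exists[OF \<open>0 < \<nu>\<close>])
  \<comment> \<open>The minus sign is the chain rule for the reflection of \<open>u\<close>.\<close>
  let ?g = "\<lambda>u. \<tau> * pos_huber_deriv A u - (1 - \<tau>) * pos_huber_deriv B (- u)"
  show "continuous_on UNIV ?g"
    unfolding pos_huber_deriv_def using assms by (intro continuous_intros) auto
  \<comment> \<open>The two parts lie in [0, \<open>\<tau>\<close>] and
    [0, \<open>1 - \<tau>\<close>], so neither they nor their difference exceed 1 in absolute
    value.\<close>
  show "\<bar>?g u\<bar> \<le> 1" for u
  proof -
    have "\<tau> * pos_huber_deriv A u \<le> \<tau>" "(1 - \<tau>) * pos_huber_deriv B (- u) \<le> 1 - \<tau>"
      using assms by (simp_all add: pos_huber_deriv_bounds mult_left_le)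
    moreover have "0 \<le> \<tau> * pos_huber_deriv A u" "0 \<le> (1 - \<tau>) * pos_huber_deriv B (- u)"
      using assms by (simp_all add: pos_huber_deriv_bounds)
    ultimately show ?thesis using assms by linarith
  qed
  show "\<tau> * pos_huber A s + (1 - \<tau>) * pos_huber B (- s) + ?g s * (u - s)
      \<le> \<tau> * pos_huber A u + (1 - \<tau>) * pos_huber B (- u)" for s u
  proof -
    have "\<tau> * (pos_huber A s + pos_huber_deriv A s * (u - s)) \<le> \<tau> * pos_huber A u"
      using assms by (simp add: pos_huber_subgradient mult_left_mono)
    moreover have "(1 - \<tau>) * (pos_huber B (- s) + pos_huber_deriv B (- s) * (- u - - s))
        \<le> (1 - \<tau>) * pos_huber B (- u)"
      using assms by (intro mult_left_mono pos_huber_subgradient) auto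
    ultimately show ?thesis by (simp add: algebra_simps)
  qed
qed

section \<open>The quantile losses as combinations of Huber functions\<close>

lemma quantile_loss_c_eq_huber:
  assumes "0 < c"
  shows "quantile_loss_c \<tau> c = (\<lambda>u. \<tau> * pos_huber c u + (1 - \<tau>) * pos_huber c (- u))"
proof
  fix u
  \<comment> \<open>At \<open>- c\<close> the two sides take different branches whose values agree.
    At 0 both Huber terms are in their quadratic branch, unlike on either side of it.\<close>
  consider "u \<ge> c" | "0 < u" "u < c" | "u = 0" | "- c < u" "u < 0" | "u = - c" | "u < - c"
    by linarith
  then show "quantile_loss_c \<tau> c u = \<tau> * pos_huber c u + (1 - \<tau>) * pos_huber c (- u)"
    unfolding quantile_loss_c_def pos_huber_def
    using assms by cases (simp_all add: field_simps power2_eq_square)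
qed

text \<open>The widths are proportional to the weights so that the weights cancel and the quadratic
  pieces on both sides of 0 have the same curvature.\<close>

lemma quantile_loss_kappa_eq_huber:
  assumes "0 < \<kappa>" "0 < \<tau>" "\<tau> < 1"
  shows "quantile_loss_kappa \<tau> \<kappa> =
    (\<lambda>u. \<tau> * pos_huber (\<tau> * \<kappa>) u + (1 - \<tau>) * pos_huber ((1 - \<tau>) * \<kappa>) (- u))"
proof
  fix u
  define A where "A = \<tau> * \<kappa>"
  define B where "B = (1 - \<tau>) * \<kappa>"
  have pos: "0 < A" "0 < B" using assms by (simp_all add: A_def B_def)
  have lower: "(\<tau> - 1) * \<kappa> = - B" by (simp add: B_def algebra_simps)
  have quadratic: "\<tau> * (u\<^sup>2 / (2 * A)) = u\<^sup>2 / (2 * \<kappa>)" "(1 - \<tau>) * (u\<^sup>2 / (2 * B)) = u\<^sup>2 / (2 * \<kappa>)"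
    using assms by (simp_all add: A_def B_def)
  \<comment> \<open>The loss puts \<open>A\<close> and \<open>- B\<close> in its quadratic piece,
    the Huber functions put them in the linear one; these identities reconcile the two.\<close>
  have knots: "A\<^sup>2 / (2 * \<kappa>) = \<tau> * (A - A / 2)" "B\<^sup>2 / (2 * \<kappa>) = (1 - \<tau>) * (B - B / 2)"
    using assms by (simp_all add: A_def B_def power2_eq_square field_simps)
  consider "A < u" | "u = A" | "0 < u" "u < A" | "u = 0" | "- B < u" "u < 0" | "u = - B" | "u < - B"
    by linarith
  then show "quantile_loss_kappa \<tau> \<kappa> u =
      \<tau> * pos_huber (\<tau> * \<kappa>) u + (1 - \<tau>) * pos_huber ((1 - \<tau>) * \<kappa>) (- u)"
    unfolding quantile_loss_kappa_def pos_huber_def lower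
    unfolding A_def[symmetric] B_def[symmetric]
  proof cases
    case 7
    have "(\<tau> - 1) * (u - - B / 2) = (1 - \<tau>) * (- u - B / 2)" by (simp add: field_simps)
    with 7 pos show "(if A < u then \<tau> * (u - A / 2) else if - B \<le> u then u\<^sup>2 / (2 * \<kappa>)
        else (\<tau> - 1) * (u - - B / 2)) =
      \<tau> * (if A \<le> u then u - A / 2 else if 0 \<le> u then u\<^sup>2 / (2 * A) else 0) +
      (1 - \<tau>) * (if B \<le> - u then - u - B / 2 else if 0 \<le> - u then (- u)\<^sup>2 / (2 * B) else 0)"
      by simp
  qed (use pos quadratic knots in simp_all)
qed

lemma strict_prox_quantile_loss_exists:
  assumes "0 < \<nu>" "0 < \<tau>" "\<tau> < 1" "0 < c" "0 < \<kappa>"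
    and "L = quantile_loss_c \<tau> c \<or> L = quantile_loss_kappa \<tau> \<kappa>"
  shows "\<exists>s. strict_prox L \<nu> v s"
  using assms
  by (auto simp: quantile_loss_c_eq_huber quantile_loss_kappa_eq_huber
      intro!: strict_prox_huber_exists)

section \<open>The proximal map of a separable loss\<close>

text \<open>The squared distance is a sum over coordinates too, so the objective splits. A
  competitor is no better in any coordinate and strictly worse in one where it differs.\<close>

lemma prox_separable:
  assumes sel: "prox_selection prox"
    and strict: "\<And>x. strict_prox L \<nu> x (S x)"
  shows "prox \<nu> (vec_loss L) v = map_vec S v"
proof -
  let ?f = "\<lambda>i x. L x + \<nu> / 2 * (x - v $ i)\<^sup>2"
  let ?G = "\<lambda>u. vec_loss L u + \<nu> / 2 * ((u - v) \<bullet> (u - v))"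
  have G: "?G u = (\<Sum>i<dim_vec v. ?f i (u $ i))" if "u \<in> carrier_vec (dim_vec v)" for u
    using that
    by (simp add: vec_loss_def scalar_prod_def sum.distrib sum_distrib_left power2_eq_square
        lessThan_atLeast0)
  have less: "?G (map_vec S v) < ?G u"
    if u: "u \<in> carrier_vec (dim_vec v)" and "u \<noteq> map_vec S v" for u :: "real vec"
  proof -
    obtain i where i: "i < dim_vec v" "u $ i \<noteq> S (v $ i)"
    proof (rule ccontr)
      assume "\<not> thesis"
      then have "u = map_vec S v" using that u by (intro eq_vecI) auto
      with \<open>u \<noteq> map_vec S v\<close> show False ..
    qed
    have "?G (map_vec S v) = (\<Sum>i<dim_vec v. ?f i (S (v $ i)))"
      by (subst G) auto
    also have "\<dots> < (\<Sum>i<dim_vec v. ?f i (u $ i))"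
    proof (rule sum_strict_mono_ex1)
      show "\<forall>i\<in>{..<dim_vec v}. ?f i (S (v $ i)) \<le> ?f i (u $ i)"
        using strict unfolding strict_prox_def by (metis order.refl order_less_imp_le)
      show "\<exists>i\<in>{..<dim_vec v}. ?f i (S (v $ i)) < ?f i (u $ i)"
        using strict i unfolding strict_prox_def by blast
    qed simp
    finally show ?thesis using G[OF u] by simp
  qed
  \<comment> \<open>A selection is constrained only where a minimizer exists, so one is exhibited
    first; uniqueness then identifies the selected value.\<close>
  have "is_prox \<nu> (vec_loss L) v (map_vec S v)"
    unfolding is_prox_def is_arg_min_def using less by (auto dest: less_asym)
  then have "is_prox \<nu> (vec_loss L) v (prox \<nu> (vec_loss L) v)"
    using sel unfolding prox_selection_def by blast
  then show ?thesis
    unfolding is_prox_def is_arg_min_def using less by (metis map_carrier_vec carrier_vec_dim_vec)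
qed

section \<open>Stacked blocks\<close>

lemma dim_stack_vec: "dim_vec (stack_vec M u) = (\<Sum>m=1..M. dim_vec (u m))"
  by (induction M) simp_all

lemma stack_vec_cong:
  "(\<And>m. m \<in> {1..M} \<Longrightarrow> u m = v m) \<Longrightarrow> stack_vec M u = stack_vec M v"
  by (induction M) simp_all

lemma map_vec_append: "map_vec f (u @\<^sub>v v) = map_vec f u @\<^sub>v map_vec f v"
  by (rule eq_vecI) auto

lemma map_stack_vec: "map_vec f (stack_vec M u) = stack_vec M (\<lambda>m. map_vec f (u m))"
  by (induction M) (auto simp: map_vec_append)

lemma smult_stack_vec: "a \<cdot>\<^sub>v stack_vec M u = stack_vec M (\<lambda>m. a \<cdot>\<^sub>v u m)"
  using map_stack_vec[of "(*) a" M u] by (simp add: smult_vec_def map_vec_def)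

lemma append_vec_diff:
  assumes "dim_vec u = dim_vec u'" "dim_vec v = dim_vec v'"
  shows "(u @\<^sub>v v) - (u' @\<^sub>v v') = (u - u') @\<^sub>v (v - v' :: 'a :: minus vec)"
  using assms by (intro eq_vecI) auto

text \<open>Agreement of the dimensions block by block, not just in total, keeps the block
  boundaries aligned.\<close>

lemma stack_vec_add:
  assumes "\<And>m. m \<in> {1..M} \<Longrightarrow> dim_vec (u m) = dim_vec (v m)"
  shows "stack_vec M u + stack_vec M v = stack_vec M (\<lambda>m. u m + v m)"
  using assms
proof (induction M)
  case (Suc M)
  have "dim_vec (stack_vec M u) = dim_vec (stack_vec M v)"
    using Suc.prems by (simp add: dim_stack_vec)
  then have "stack_vec (Suc M) u + stack_vec (Suc M) v
      = (stack_vec M u + stack_vec M v) @\<^sub>v (u (Suc M) + v (Suc M))"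
    using Suc.prems[of "Suc M"] by (simp add: append_vec_add[OF carrier_vecI carrier_vecI carrier_vecI carrier_vecI,
          OF _ refl _ refl])
  then show ?case using Suc by simp
qed auto

lemma stack_vec_diff:
  assumes "\<And>m. m \<in> {1..M} \<Longrightarrow> dim_vec (u m) = dim_vec (v m)"
  shows "stack_vec M u - stack_vec M v = stack_vec M (\<lambda>m. u m - v m)"
  using assms
proof (induction M)
  case (Suc M)
  have "dim_vec (stack_vec M u) = dim_vec (stack_vec M v)"
    using Suc.prems by (simp add: dim_stack_vec)
  then show ?case
    using Suc by (simp add: append_vec_diff)
qed simp

section \<open>Products with stacked matrices\<close>

lemma stack_rows_carrier:
  assumes "\<And>m. m \<in> {1..M} \<Longrightarrow> A m \<in> carrier_mat (nb m) p"
  shows "stack_rows p M A \<in> carrier_mat (\<Sum>m=1..M. nb m) p"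
  using assms by (induction M) auto

lemma stack_rows_mult_vec:
  assumes "\<And>m. m \<in> {1..M} \<Longrightarrow> A m \<in> carrier_mat (nb m) p" and "b \<in> carrier_vec p"
  shows "stack_rows p M A *\<^sub>v b = stack_vec M (\<lambda>m. A m *\<^sub>v b)"
  using assms
proof (induction M)
  case 0
  then show ?case by (intro eq_vecI) auto
next
  case (Suc M)
  have last: "A (Suc M) \<in> carrier_mat (nb (Suc M)) p"
    using Suc.prems by simp
  have rows: "stack_rows p M A \<in> carrier_mat (\<Sum>m=1..M. nb m) p"
    using Suc.prems by (intro stack_rows_carrier) simp
  show ?case
    using Suc mat_mult_append[OF rows last \<open>b \<in> carrier_vec p\<close>] by simp
qed

text \<open>Each column of the stacked matrix is a column of \<open>A\<close> followed by one of
  \<open>B\<close>, so its inner product with \<open>u @\<^sub>v v\<close> splits.\<close>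

lemma append_rows_transpose_mult_append:
  assumes A: "A \<in> carrier_mat nr1 nc" and B: "B \<in> carrier_mat nr2 nc"
    and u: "u \<in> carrier_vec nr1" and v: "v \<in> carrier_vec nr2"
  shows "(A @\<^sub>r B)\<^sup>T *\<^sub>v (u @\<^sub>v v) = A\<^sup>T *\<^sub>v u + B\<^sup>T *\<^sub>v v"
proof -
  have cols: "dim_col (A @\<^sub>r B) = nc"
    using carrier_append_rows[OF A B] by (rule carrier_matD)
  show ?thesis
  proof (rule eq_vecI)
    fix j assume "j < dim_vec (A\<^sup>T *\<^sub>v u + B\<^sup>T *\<^sub>v v)"
    then have j: "j < nc" using B by simp
    \<comment> \<open>\<open>append_rows\<close> is a four-block matrix whose right-hand blocks have
      no columns, so \<open>j\<close> falls in the left-hand ones.\<close>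
    have "col (A @\<^sub>r B) j = col A j @\<^sub>v col B j"
      unfolding append_rows_def
      using A B j col_four_block_mat(1)[of A nr1 nc "0\<^sub>m nr1 0" 0 B nr2 "0\<^sub>m nr2 0" j] by simp
    moreover have "(col A j @\<^sub>v col B j) \<bullet> (u @\<^sub>v v) = col A j \<bullet> u + col B j \<bullet> v"
      using A B u v by (intro scalar_prod_append) auto
    ultimately show "((A @\<^sub>r B)\<^sup>T *\<^sub>v (u @\<^sub>v v)) $ j = (A\<^sup>T *\<^sub>v u + B\<^sup>T *\<^sub>v v) $ j"
      using A B j cols by simp
  qed (use cols B in simp)
qed

lemma stack_rows_transpose_mult_stack_vec:
  assumes "\<And>m. m \<in> {1..M} \<Longrightarrow> A m \<in> carrier_mat (nb m) p"
    and "\<And>m. m \<in> {1..M} \<Longrightarrow> v m \<in> carrier_vec (nb m)"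
  shows "(stack_rows p M A)\<^sup>T *\<^sub>v stack_vec M v
    = finsum_vec TYPE(real) p (\<lambda>m. (A m)\<^sup>T *\<^sub>v v m) {1..M}"
  using assms
proof (induction M)
  case 0
  then show ?case by (intro eq_vecI) (auto simp: finsum_vec_empty)
next
  case (Suc M)
  let ?\<xi> = "\<lambda>m. (A m)\<^sup>T *\<^sub>v v m"
  have last: "A (Suc M) \<in> carrier_mat (nb (Suc M)) p" "v (Suc M) \<in> carrier_vec (nb (Suc M))"
    using Suc.prems by auto
  have rows: "stack_rows p M A \<in> carrier_mat (\<Sum>m=1..M. nb m) p"
    using Suc.prems by (intro stack_rows_carrier) auto
  have "dim_vec (stack_vec M v) = (\<Sum>m=1..M. nb m)"
    unfolding dim_stack_vec using Suc.prems(2) by (intro sum.cong) auto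
  then have vecs: "stack_vec M v \<in> carrier_vec (\<Sum>m=1..M. nb m)"
    by (rule carrier_vecI)
  have \<xi>: "?\<xi> m \<in> carrier_vec p" if "m \<in> {1..Suc M}" for m
    using Suc.prems(1)[OF that] by (intro carrier_vecI) simp
  \<comment> \<open>Insertion puts the new summand in front while stacking appends it at the end,
    hence the commutation that follows.\<close>
  have "finsum_vec TYPE(real) p ?\<xi> {1..Suc M} = ?\<xi> (Suc M) + finsum_vec TYPE(real) p ?\<xi> {1..M}"
    unfolding atLeastAtMostSuc_conv[OF le_add1[of 1 M, unfolded plus_1_eq_Suc]]
    by (rule finsum_vec_insert) (use \<xi> in auto)
  also have "\<dots> = (stack_rows p M A)\<^sup>T *\<^sub>v stack_vec M v + ?\<xi> (Suc M)"
    using Suc comm_add_vec[OF \<xi>[of "Suc M"] finsum_vec_closed[of ?\<xi> "{1..M}" p]] \<xi> by auto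
  finally show ?case
    using append_rows_transpose_mult_append[OF rows last(1) vecs last(2)] by simp
qed

section \<open>Equality of the iterates\<close>

theorem theorem1:
  fixes \<tau> c \<kappa> \<mu> \<eta> lam1 lam2 a :: real
    and L q :: "real \<Rightarrow> real"
    and prox :: "real \<Rightarrow> (real vec \<Rightarrow> real) \<Rightarrow> real vec \<Rightarrow> real vec"
    and n p M :: nat and nb :: "nat \<Rightarrow> nat"
    and X :: "real mat" and y :: "real vec"
    and Xb :: "nat \<Rightarrow> real mat" and yb :: "nat \<Rightarrow> real vec"
    and \<beta>h rh dh \<beta>t :: "nat \<Rightarrow> real vec"
    and rt dt :: "nat \<Rightarrow> nat \<Rightarrow> real vec"
  assumes "0 < \<tau>" "\<tau> < 1" "0 < c" "0 < \<kappa>" "0 < \<mu>" "0 < \<eta>" "0 < lam1" "0 \<le> lam2"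
    and loss: "L = quantile_loss_c \<tau> c \<or> L = quantile_loss_kappa \<tau> \<kappa>"
    and pen: "(2 < a \<and> is_scad lam1 a q) \<or> (1 < a \<and> q = mcp lam1 a) \<or> (0 < a \<and> q = capped_l1 lam1 a)"
    and prox: "prox_selection prox"
    and "2 \<le> M"
    and "X \<in> carrier_mat n p" "y \<in> carrier_vec n"
    and "\<And>m. m \<in> {1..M} \<Longrightarrow> Xb m \<in> carrier_mat (nb m) p"
    and "\<And>m. m \<in> {1..M} \<Longrightarrow> yb m \<in> carrier_vec (nb m)"
    and "(\<Sum>m=1..M. nb m) = n"
    and split: "X = stack_rows p M Xb" "y = stack_vec M yb"
    and init_dims: "\<beta>t 0 \<in> carrier_vec p"
      "\<And>m. m \<in> {1..M} \<Longrightarrow> rt 0 m \<in> carrier_vec (nb m)"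
      "\<And>m. m \<in> {1..M} \<Longrightarrow> dt 0 m \<in> carrier_vec (nb m)"
    and ladmm: "is_ladmm prox (vec_loss L) (vec_penalty q lam2) \<mu> \<eta> X y \<beta>h rh dh"
    and parallel: "is_parallel_ladmm prox (vec_loss L) (vec_penalty q lam2) \<mu> \<eta> p M Xb yb \<beta>t rt dt"
    and init: "\<beta>h 0 = \<beta>t 0" "rh 0 = stack_vec M (rt 0)" "dh 0 = stack_vec M (dt 0)"
  shows "\<forall>k. \<beta>h k = \<beta>t k \<and> rh k = stack_vec M (rt k) \<and> dh k = stack_vec M (dt k)"
proof -
  note X = assms(15) and y = assms(16)
  note Lad = ladmm[unfolded is_ladmm_def, rule_format]
  note Par = parallel[unfolded is_parallel_ladmm_def Let_def, rule_format]
  \<comment> \<open>One scalar map \<open>S\<close> serves vectors of every dimension, hence each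
    block as well as the whole vector.\<close>
  obtain S where "\<And>x. strict_prox L \<mu> x (S x)"
    using strict_prox_quantile_loss_exists[OF \<open>0 < \<mu>\<close> \<open>0 < \<tau>\<close> \<open>\<tau> < 1\<close> \<open>0 < c\<close> \<open>0 < \<kappa>\<close> loss] by metis
  then have prox_loss: "prox \<mu> (vec_loss L) v = map_vec S v" for v
    using prox_separable[OF prox] by blast
  \<comment> \<open>This keeps the \<open>\<beta>t\<close> iterates in dimension \<open>p\<close>,
    where the penalty may have several minimizers.\<close>
  have prox_dim: "dim_vec (prox \<nu> g v) = dim_vec v" for \<nu> g v
    using prox unfolding prox_selection_def by auto
  \<comment> \<open>The induction also carries the dimensions, since sums and differences of stacked
    vectors merge only when the blocks conform.\<close>
  have "(\<beta>h k = \<beta>t k \<and> rh k = stack_vec M (rt k) \<and> dh k = stack_vec M (dt k)) \<and>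
      \<beta>t k \<in> carrier_vec p \<and>
      (\<forall>m\<in>{1..M}. rt k m \<in> carrier_vec (nb m) \<and> dt k m \<in> carrier_vec (nb m))" for k
  proof (induction k)
    case 0
    show ?case using init init_dims by blast
  next
    case (Suc k)
    have dims: "dim_row (Xb m) = nb m" "dim_vec (yb m) = nb m"
      "dim_vec (rt k m) = nb m" "dim_vec (dt k m) = nb m" if "m \<in> {1..M}" for m
      using X[OF that] y[OF that] Suc.IH that by auto
    have Xmult: "stack_rows p M Xb *\<^sub>v b = stack_vec M (\<lambda>m. Xb m *\<^sub>v b)" if "b \<in> carrier_vec p" for b
      by (rule stack_rows_mult_vec[OF X that])
    let ?v = "\<lambda>m. Xb m *\<^sub>v \<beta>t k + rt k m - yb m - (1 / \<mu>) \<cdot>\<^sub>v dt k m"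
    let ?\<xi> = "\<lambda>m. (Xb m)\<^sup>T *\<^sub>v ?v m"
    have "X *\<^sub>v \<beta>h k + rh k - y - (1 / \<mu>) \<cdot>\<^sub>v dh k = stack_vec M ?v"
      using Suc.IH by (simp add: Xmult split smult_stack_vec)
        (subst stack_vec_add stack_vec_diff | simp add: dims)+
    moreover have "X\<^sup>T *\<^sub>v stack_vec M ?v = finsum_vec TYPE(real) p ?\<xi> {1..M}"
      unfolding split
      by (rule stack_rows_transpose_mult_stack_vec[OF X]) (auto intro!: carrier_vecI simp: dims)
    \<comment> \<open>Both algorithms now apply the same function \<open>prox\<close> to the same
      arguments, so any selection gives the same result.\<close>
    ultimately have \<beta>: "\<beta>h (Suc k) = \<beta>t (Suc k)"
      using Lad[of k] Par[of k] Suc.IH by simp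
    have "?\<xi> \<in> {1..M} \<rightarrow> carrier_vec p"
      using carrier_matD(2)[OF X] by (auto intro!: carrier_vecI)
    then have "finsum_vec TYPE(real) p ?\<xi> {1..M} \<in> carrier_vec p"
      by (rule finsum_vec_closed)
    \<comment> \<open>A difference of vectors takes its dimension from the subtracted one, here the
      block sum.\<close>
    then have \<beta>_carrier: "\<beta>t (Suc k) \<in> carrier_vec p"
      using Par[of k] by (intro carrier_vecI) (simp add: prox_dim)
    have r_block: "rt (Suc k) m = map_vec S (yb m + (1 / \<mu>) \<cdot>\<^sub>v dt k m - Xb m *\<^sub>v \<beta>t (Suc k))"
      if "m \<in> {1..M}" for m
      using Par[of k] that by (simp add: prox_loss)
    have d_block: "dt (Suc k) m = dt k m - \<mu> \<cdot>\<^sub>v (Xb m *\<^sub>v \<beta>t (Suc k) + rt (Suc k) m - yb m)"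
      if "m \<in> {1..M}" for m
      using Par[of k] that by simp
    have r_dim: "dim_vec (rt (Suc k) m) = nb m" if "m \<in> {1..M}" for m
      using that by (simp add: r_block dims)
    have d_dim: "dim_vec (dt (Suc k) m) = nb m" if "m \<in> {1..M}" for m
      using that by (simp add: d_block dims)
    have "rh (Suc k) = map_vec S (y + (1 / \<mu>) \<cdot>\<^sub>v dh k - X *\<^sub>v \<beta>t (Suc k))"
      using Lad[of k] \<beta> by (simp add: prox_loss)
    \<comment> \<open>The argument is assembled blockwise, and the coordinatewise map
      \<open>S\<close> then passes inside the stack.\<close>
    also have "\<dots> = stack_vec M
        (\<lambda>m. map_vec S (yb m + (1 / \<mu>) \<cdot>\<^sub>v dt k m - Xb m *\<^sub>v \<beta>t (Suc k)))"
      using Suc.IH \<beta>_carrier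
      by (simp add: Xmult split smult_stack_vec)
        (subst stack_vec_add stack_vec_diff | simp add: dims map_stack_vec)+
    also have "\<dots> = stack_vec M (rt (Suc k))"
      by (rule stack_vec_cong) (simp add: r_block)
    finally have r: "rh (Suc k) = stack_vec M (rt (Suc k))" .
    have "dh (Suc k) = dh k - \<mu> \<cdot>\<^sub>v (X *\<^sub>v \<beta>t (Suc k) + rh (Suc k) - y)"
      using Lad[of k] \<beta> by simp
    \<comment> \<open>The dual update is linear, so it acts blockwise once \<open>r\<close> has
      replaced \<open>rh (Suc k)\<close> by a stack.\<close>
    also have "\<dots> = stack_vec M
        (\<lambda>m. dt k m - \<mu> \<cdot>\<^sub>v (Xb m *\<^sub>v \<beta>t (Suc k) + rt (Suc k) m - yb m))"
      using Suc.IH \<beta>_carrier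
      by (simp add: r Xmult split)
        (subst stack_vec_add stack_vec_diff smult_stack_vec | simp add: dims r_dim)+
    also have "\<dots> = stack_vec M (dt (Suc k))"
      by (rule stack_vec_cong) (simp add: d_block)
    finally show ?case
      using \<beta> r \<beta>_carrier r_dim d_dim by (auto intro: carrier_vecI)
  qed
  then show ?thesis by blast
qed

end
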